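(* Let $k\ge 2$ and $n\ge 1$ be integers, and let $f:\mathfrak T^n\to\mathbb R$ be $k$-submodular with $f(\mathbf 0)=0$. Then $$\min_{T\in\mathfrak T^n} f(T)=\max_{(x,L)\in U(f)} -\|x\|,$$ where $U(f)$ and $\|x\|$ are as defined in the context.
   Context: $\mathfrak T$ is a set consisting of a root $\mathbf o$ and a set $\mathfrak L$ of exactly $k$ leaves. Binary operations $\sqcap,\sqcup$ on $\mathfrak T$ are defined by: $t\sqcap t=t\sqcup t=t$ for all $t$; for distinct leaves $a,b$: $a\sqcap b=a\sqcup b=\mathbf o$; for a leaf $a$: $a\sqcap\mathbf o=\mathbf o\sqcap a=\mathbf o$ and $a\sqcup \mathbf o=\mathbf o\sqcup a=a$. On $\mathfrak T^n$ these operations act componentwise, and $\mathbf 0=(\mathbf o,\dots,\mathbf o)$. A function $f:\mathfrak T^n\to\mathbb R$ is $k$-submodular if $f(T\sqcap U)+f(T\sqcup U)\le f(T)+f(U)$ for all $T,U\in\mathfrak T^n$. For $(x,L)\in\mathbb R_{\ge0}^n\times\mathfrak L^n$ define $\overline{(x,L)}:\mathfrak T^n\to\mathbb R$ by $\overline{(x,L)}(T)=\sum_{i=1}^n\overline{(x,L)}_i(T_i)$, where $\overline{(x,L)}_i(\mathbf o)=0$, $\overline{(x,L)}_i(L_i)=x_i$, and $\overline{(x,L)}_i(\ell)=-x_i$ for every leaf $\ell\ne L_i$. Define $U(f)=\{(x,L)\in\mathbb R_{\ge0}^n\times\mathfrak L^n : \overline{(x,L)}(T)\le f(T)\text{ for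 all }T\in\mathfrak T^n\}$ and $\|x\|=\sum_{i=1}^n x_i$ for $x\in\mathbb R^n_{\ge0}$. *)

theory Defs
  imports "HOL-Analysis.Finite_Cartesian_Product"
begin

text \<open>The leaves are the elements of a finite type \<^typ>\<open>'l\<close>, so that there are \<open>k = CARD('l)\<close>
  of them; the root is \<^term>\<open>None\<close> and the leaf \<open>a\<close> is \<^term>\<open>Some a\<close>.
  The index set \<open>{1..n}\<close> is a finite type \<^typ>\<open>'n\<close> with \<open>n = CARD('n)\<close>.\<close>

type_synonym 'l tree = "'l option"

fun tree_meet :: "'l tree \<Rightarrow> 'l tree \<Rightarrow> 'l tree" where
  "tree_meet None t = None"
| "tree_meet (Some a) None = None"
| "tree_meet (Some a) (Some b) = (if a = b then Some a else None)"

fun tree_join :: "'l tree \<Rightarrow> 'l tree \<Rightarrow> 'l tree" where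
  "tree_join None t = t"
| "tree_join (Some a) None = Some a"
| "tree_join (Some a) (Some b) = (if a = b then Some a else None)"

definition vmeet :: "'l tree ^ 'n \<Rightarrow> 'l tree ^ 'n \<Rightarrow> 'l tree ^ 'n"  (infixl "\<sqinter>\<^sub>T" 70) where
  "T \<sqinter>\<^sub>T U = (\<chi> i. tree_meet (T $ i) (U $ i))"

definition vjoin :: "'l tree ^ 'n \<Rightarrow> 'l tree ^ 'n \<Rightarrow> 'l tree ^ 'n"  (infixl "\<squnion>\<^sub>T" 65) where
  "T \<squnion>\<^sub>T U = (\<chi> i. tree_join (T $ i) (U $ i))"

definition root_vec :: "'l tree ^ 'n" where
  "root_vec = (\<chi> i. None)"

definition k_submodular :: "('l tree ^ 'n \<Rightarrow> real) \<Rightarrow> bool" where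
  "k_submodular f \<longleftrightarrow> (\<forall>T U. f (T \<sqinter>\<^sub>T U) + f (T \<squnion>\<^sub>T U) \<le> f T + f U)"

fun bar_comp :: "real \<Rightarrow> 'l \<Rightarrow> 'l tree \<Rightarrow> real" where
  "bar_comp r l None = 0"
| "bar_comp r l (Some a) = (if a = l then r else - r)"

definition bar :: "real ^ 'n \<Rightarrow> 'l ^ 'n \<Rightarrow> 'l tree ^ 'n \<Rightarrow> real" where
  "bar x L T = (\<Sum>i\<in>UNIV. bar_comp (x $ i) (L $ i) (T $ i))"

definition unified_poly :: "('l tree ^ 'n \<Rightarrow> real) \<Rightarrow> ((real ^ 'n) \<times> ('l ^ 'n)) set" where
  "unified_poly f = {(x, L). (\<forall>i. 0 \<le> x $ i) \<and> (\<forall>T. bar x L T \<le> f T)}"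

text \<open>The sum of the coordinates, which is the \<open>\<ell>\<^sub>1\<close>-norm on nonnegative vectors; \<^const>\<open>norm\<close> on
  \<^typ>\<open>real ^ 'n\<close> would be the Euclidean norm.\<close>

definition coord_sum :: "real ^ 'n \<Rightarrow> real" where
  "coord_sum x = (\<Sum>i\<in>UNIV. x $ i)"

text \<open>\<^const>\<open>Max\<close> is meaningful only on finite sets, and \<^const>\<open>Sup\<close> does not express
  attainment.\<close>

definition is_minimum :: "real \<Rightarrow> real set \<Rightarrow> bool" where
  "is_minimum m S \<longleftrightarrow> m \<in> S \<and> (\<forall>y\<in>S. m \<le> y)"

definition is_maximum :: "real \<Rightarrow> real set \<Rightarrow> bool" where
  "is_maximum m S \<longleftrightarrow> m \<in> S \<and> (\<forall>y\<in>S. y \<le> m)"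

end

theory Submission
  imports Defs
begin

text \<open>Subtracting \<open>bar\<close> of a single coordinate and then minimising over that coordinate preserves
  k-submodularity, so the coordinates can be eliminated one at a time. Let \<open>h(t)\<close> be the minimum of
  \<open>f\<close> over the vectors with entry \<open>t\<close> at coordinate \<open>i\<close>. The right choice is
  \<open>x\<^sub>i = h(\<^bold>o) - min f\<close>, with \<open>L\<^sub>i\<close> any leaf different from the \<open>i\<close>-th entry of a minimiser of \<open>f\<close>:
  it keeps the value at the root vector equal to \<open>0\<close> and raises the minimum by exactly \<open>x\<^sub>i\<close>.\<close>

definition set_coord :: "'a ^ 'n \<Rightarrow> 'n \<Rightarrow> 'a \<Rightarrow> 'a ^ 'n" where
  "set_coord T i t = (\<chi> j. if j = i then t else T $ j)"

lemma set_coord_nth: "set_coord T i t $ j = (if j = i then t else T $ j)"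
  by (simp add: set_coord_def)

lemma set_coord_triv [simp]: "set_coord T i (T $ i) = T"
  by (simp add: vec_eq_iff set_coord_nth)

lemma tree_meet_None_right [simp]: "tree_meet t None = None"
  by (cases t) auto

lemma tree_join_None_right [simp]: "tree_join t None = t"
  by (cases t) auto

lemma vmeet_set_coord:
  "set_coord T i t \<sqinter>\<^sub>T set_coord U i u = set_coord (T \<sqinter>\<^sub>T U) i (tree_meet t u)"
  by (simp add: vec_eq_iff set_coord_nth vmeet_def)

lemma vjoin_set_coord:
  "set_coord T i t \<squnion>\<^sub>T set_coord U i u = set_coord (T \<squnion>\<^sub>T U) i (tree_join t u)"
  by (simp add: vec_eq_iff set_coord_nth vjoin_def)

lemma vmeet_root_left [simp]: "root_vec \<sqinter>\<^sub>T T = root_vec"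
  by (simp add: vec_eq_iff vmeet_def root_vec_def)

lemma vjoin_root_left [simp]: "root_vec \<squnion>\<^sub>T T = T"
  by (simp add: vec_eq_iff vjoin_def root_vec_def)

lemma set_coord_root [simp]: "set_coord root_vec i None = root_vec"
  by (simp add: vec_eq_iff set_coord_nth root_vec_def)

lemma k_submodularD:
  "k_submodular f \<Longrightarrow> f (T \<sqinter>\<^sub>T U) + f (T \<squnion>\<^sub>T U) \<le> f T + f U"
  by (simp add: k_submodular_def)

lemma ex_minimiser:
  fixes f :: "'a::finite \<Rightarrow> real"
  obtains a where "\<And>b. f a \<le> f b"
proof -
  have "Min (range f) \<in> range f"
    by (rule Min_in) auto
  then obtain a where "f a = Min (range f)"
    by (metis rangeE)
  then have "\<And>b. f a \<le> f b"
    by (simp add: Min_le)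
  then show thesis
    by (rule that)
qed

text \<open>Equality holds unless \<open>t\<close> and \<open>u\<close> are distinct leaves. In that
  case meet and join are both the root, so the right side is 0, while at most one of the two leaves
  is \<open>l\<close>, so the left side is 0 or \<open>- 2 * r\<close>.\<close>

lemma bar_comp_supermodular:
  "0 \<le> r \<Longrightarrow>
    bar_comp r l t + bar_comp r l u \<le> bar_comp r l (tree_meet t u) + bar_comp r l (tree_join t u)"
  by (cases t; cases u) auto

lemma bar_comp_ge: "0 \<le> r \<Longrightarrow> - r \<le> bar_comp r l t"
  by (cases t) auto

lemma bar_ge_neg_coord_sum:
  assumes "\<And>i. 0 \<le> x $ i"
  shows "- coord_sum x \<le> bar x L T"
  using assms unfolding coord_sum_def bar_def sum_negf [symmetric]
  by (intro sum_mono bar_comp_ge)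

text \<open>Coordinate \<open>i\<close> contributes 0 before the update, whatever
  \<open>L $ i\<close> is. This lets an eliminated coordinate be restored with any value and any
  leaf.\<close>

lemma bar_set_coord:
  assumes "x $ i = 0"
  shows "bar (set_coord x i r) (set_coord L i l) T = bar x L T + bar_comp r l (T $ i)"
proof -
  have [simp]: "bar_comp 0 l' t = 0" for l' :: 'b and t
    by (cases t) auto
  have "(\<Sum>j\<in>UNIV - {i}. bar_comp (set_coord x i r $ j) (set_coord L i l $ j) (T $ j))
      = (\<Sum>j\<in>UNIV - {i}. bar_comp (x $ j) (L $ j) (T $ j))"
    by (rule sum.cong) (auto simp: set_coord_nth)
  then show ?thesis
    using assms by (simp add: bar_def sum.remove [of UNIV i] set_coord_nth)
qed

lemma coord_sum_set_coord:
  assumes "x $ i = 0"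
  shows "coord_sum (set_coord x i r) = coord_sum x + r"
proof -
  have "(\<Sum>j\<in>UNIV - {i}. set_coord x i r $ j) = (\<Sum>j\<in>UNIV - {i}. x $ j)"
    by (rule sum.cong) (auto simp: set_coord_nth)
  then show ?thesis
    using assms by (simp add: coord_sum_def sum.remove [of UNIV i] set_coord_nth)
qed

text \<open>The last two conclusions are what eliminating coordinate \<open>i\<close> needs: after
  subtraction and minimisation the value at the root vector is not negative, and every value is at
  least \<open>f M + r\<close>.\<close>

lemma k_submodular_coord_reduction:
  fixes f :: "('l::finite) tree ^ ('n::finite) \<Rightarrow> real"
  assumes card: "2 \<le> CARD('l)" and sub: "k_submodular f" and root: "f root_vec = 0"
    and min: "\<And>T. f M \<le> f T"
  obtains r l where "0 \<le> r"
    and "\<And>t. bar_comp r l t \<le> f (set_coord root_vec i t)"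
    and "\<And>T. f M + r \<le> f T - bar_comp r l (T $ i)"
proof -
  obtain N where N: "\<And>T. f (set_coord N i None) \<le> f (set_coord T i None)"
    using ex_minimiser [of "\<lambda>T. f (set_coord T i None)"] by blast
  define c where "c = f (set_coord N i None)"
  define r where "r = c - f M"
  \<comment> \<open>Otherwise every leaf would equal the entry of \<open>M\<close>, contradicting k
    \<ge> 2.\<close>
  have "\<exists>l. M $ i \<noteq> Some l"
  proof (rule ccontr)
    assume "\<nexists>l. M $ i \<noteq> Some l"
    then have "\<And>l l' :: 'l. l = l'"
      by (metis option.inject)
    then have "(UNIV :: 'l set) = {undefined}"
      by auto
    then have "CARD('l) = 1"
      by (metis card_1_singleton_iff One_nat_def)
    with card show False
      by simp
  qed
  then obtain l where l: "M $ i \<noteq> Some l"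
    by blast
  have r: "0 \<le> r"
    using min by (simp add: r_def c_def)
  \<comment> \<open>If \<open>M\<close> has the root at \<open>i\<close>, then
    \<open>c = f M\<close> and \<open>r = 0\<close>. Otherwise its entry there is a leaf other than
    \<open>l\<close>, so meet and join with \<open>M\<close> both have the root at \<open>i\<close>
    and value at least \<open>c\<close>. Submodularity then gives the bound
    \<open>2 * c - f M\<close>, which is \<open>f M + 2 * r\<close>.\<close>
  have at_l: "f M + 2 * r \<le> f (set_coord T i (Some l))" for T
  proof (cases "M $ i")
    case None
    then have "c \<le> f M"
      using N [of M] set_coord_triv [of M i] by (simp add: c_def)
    then show ?thesis
      using min [of "set_coord T i (Some l)"] by (simp add: r_def)
  next
    case (Some a)
    then have "set_coord M i (Some a) = M"
      using set_coord_triv [of M i] by simp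
    moreover have "l \<noteq> a"
      using l Some by simp
    ultimately have "f (set_coord (T \<sqinter>\<^sub>T M) i None) + f (set_coord (T \<squnion>\<^sub>T M) i None)
        \<le> f (set_coord T i (Some l)) + f M"
      using k_submodularD [OF sub, of "set_coord T i (Some l)" "set_coord M i (Some a)"]
      unfolding vmeet_set_coord vjoin_set_coord by simp
    then show ?thesis
      using N [of "T \<sqinter>\<^sub>T M"] N [of "T \<squnion>\<^sub>T M"] by (simp add: r_def c_def)
  qed
  \<comment> \<open>The meet of the two vectors is the root vector, where \<open>f\<close> is 0, and
    their join is \<open>set_coord N i t\<close>.\<close>
  have at_root: "f (set_coord N i t) - c \<le> f (set_coord root_vec i t)" for t
    using k_submodularD [OF sub, of "set_coord root_vec i t" "set_coord N i None"] root
    by (simp add: vmeet_set_coord vjoin_set_coord c_def)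
  show thesis
  proof (rule that [OF r])
    fix t
    \<comment> \<open>By \<open>at_root\<close>, the right side is at least
      \<open>f M + 2 * r - c = r\<close> at the leaf \<open>l\<close>, and at least
      \<open>f M - c = - r\<close> at any other leaf.\<close>
    show "bar_comp r l t \<le> f (set_coord root_vec i t)"
      using at_root [of t] at_l [of N] min [of "set_coord N i t"] root
      by (cases t) (auto simp: r_def)
  next
    fix T
    show "f M + r \<le> f T - bar_comp r l (T $ i)"
      using at_l [of T] min [of T] N [of T] set_coord_triv [of T i]
      by (cases "T $ i") (auto simp: r_def c_def)
  qed
qed

text \<open>If \<open>t\<close> and \<open>u\<close> attain the minima for \<open>T\<close> and
  \<open>U\<close>, then their meet and join are candidates in the minima on the left. Subtracting a
  supermodular term keeps the inequality for \<open>f\<close>.\<close>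

lemma k_submodular_partial_min:
  fixes f :: "('l::finite) tree ^ ('n::finite) \<Rightarrow> real"
  assumes sub: "k_submodular f" and r: "0 \<le> r"
  shows "k_submodular (\<lambda>T. Min (range (\<lambda>t. f (set_coord T i t) - bar_comp r l t)))"
    (is "k_submodular ?g")
  unfolding k_submodular_def
proof (intro allI)
  fix T U :: "'l tree ^ 'n"
  have attained: "\<exists>t. ?g V = f (set_coord V i t) - bar_comp r l t" for V
  proof -
    have "?g V \<in> range (\<lambda>t. f (set_coord V i t) - bar_comp r l t)"
      by (rule Min_in) auto
    then show ?thesis
      by (metis (no_types, lifting) rangeE)
  qed
  have le: "?g V \<le> f (set_coord V i t) - bar_comp r l t" for V t
    by (rule Min_le) auto
  obtain t where t: "?g T = f (set_coord T i t) - bar_comp r l t"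
    using attained by blast
  obtain u where u: "?g U = f (set_coord U i u) - bar_comp r l u"
    using attained by blast
  show "?g (T \<sqinter>\<^sub>T U) + ?g (T \<squnion>\<^sub>T U) \<le> ?g T + ?g U"
    using le [of "T \<sqinter>\<^sub>T U" "tree_meet t u"] le [of "T \<squnion>\<^sub>T U" "tree_join t u"]
      k_submodularD [OF sub, of "set_coord T i t" "set_coord U i u"]
      bar_comp_supermodular [OF r, of l t u]
    unfolding t u vmeet_set_coord vjoin_set_coord by linarith
qed

text \<open>Induction on a set \<open>S\<close> containing all coordinates on which \<open>f\<close>
  depends; for empty \<open>S\<close>, \<open>f\<close> is constantly 0. The support condition on
  \<open>x\<close> makes its entry at a new coordinate 0, so that it can be overwritten.\<close>

lemma unified_poly_attains_min:
  fixes f :: "('l::finite) tree ^ ('n::finite) \<Rightarrow> real"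
  assumes card: "2 \<le> CARD('l)" and "k_submodular f" and "f root_vec = 0"
    and "\<And>T U. (\<And>i. i \<in> S \<Longrightarrow> T $ i = U $ i) \<Longrightarrow> f T = f U"
  shows "\<exists>x L T. (x, L) \<in> unified_poly f \<and> (\<forall>i. i \<notin> S \<longrightarrow> x $ i = 0) \<and> coord_sum x \<le> - f T"
proof -
  have "finite S"
    by simp
  then show ?thesis
    using assms(2-4)
  proof (induction S arbitrary: f rule: finite_induct)
    case empty
    then have f: "f T = 0" for T
      by (metis empty_iff)
    have "bar 0 L T = 0" for L :: "'l ^ 'n" and T
      unfolding bar_def
    proof (rule sum.neutral, rule)
      show "bar_comp (0 $ j) (L $ j) (T $ j) = 0" for j
        by (cases "T $ j") auto
    qed
    then have "(0, L) \<in> unified_poly f" for L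
      by (simp add: unified_poly_def f)
    moreover have "coord_sum (0 :: real ^ 'n) = 0"
      by (simp add: coord_sum_def)
    ultimately show ?case
      using f by (metis neg_0_equal_iff_equal order_refl zero_index)
  next
    case (insert i S)
    obtain M where M: "\<And>T. f M \<le> f T"
      using ex_minimiser [of f] by blast
    obtain r l where r: "0 \<le> r"
      and at_root: "\<And>t. bar_comp r l t \<le> f (set_coord root_vec i t)"
      and above: "\<And>T. f M + r \<le> f T - bar_comp r l (T $ i)"
      using k_submodular_coord_reduction [OF card insert.prems(1,2) M, of i] by blast
    \<comment> \<open>Minimising over the entry at \<open>i\<close> makes \<open>g\<close>
      independent of that coordinate, so the induction hypothesis for \<open>S\<close> applies to
      \<open>g\<close>.\<close>
    define g where "g = (\<lambda>T. Min (range (\<lambda>t. f (set_coord T i t) - bar_comp r l t)))"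
    have g_le: "g T \<le> f T - bar_comp r l (T $ i)" for T
    proof -
      have "g T \<le> f (set_coord T i (T $ i)) - bar_comp r l (T $ i)"
        unfolding g_def by (intro Min_le finite_imageI finite rangeI)
      then show ?thesis
        by simp
    qed
    have g_ge: "f M + r \<le> g T" for T
      unfolding g_def
    proof (subst Min_ge_iff; clarsimp)
      show "f M + r \<le> f (set_coord T i t) - bar_comp r l t" for t
        using above [of "set_coord T i t"] by (simp add: set_coord_nth)
    qed
    have "k_submodular g"
      unfolding g_def by (rule k_submodular_partial_min [OF insert.prems(1) r])
    moreover have "g root_vec = 0"
    proof (rule antisym)
      show "g root_vec \<le> 0"
        using g_le [of root_vec] insert.prems(2) by (simp add: root_vec_def)
      show "0 \<le> g root_vec"
        unfolding g_def using at_root by (subst Min_ge_iff) auto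
    qed
    moreover have "g T = g U" if "\<And>j. j \<in> S \<Longrightarrow> T $ j = U $ j" for T U
    proof -
      have "f (set_coord T i t) = f (set_coord U i t)" for t
        using that by (intro insert.prems(3)) (auto simp: set_coord_nth)
      then show ?thesis
        by (simp add: g_def)
    qed
    ultimately obtain x L T where xL: "(x, L) \<in> unified_poly g"
      and supp: "\<And>j. j \<notin> S \<Longrightarrow> x $ j = 0" and sum: "coord_sum x \<le> - g T"
      using insert.IH [of g] by blast
    have xi: "x $ i = 0"
      using supp insert.hyps by blast
    have "bar x L U + bar_comp r l (U $ i) \<le> f U" for U
    proof -
      have "bar x L U \<le> g U"
        using xL by (simp add: unified_poly_def)
      then show ?thesis
        using g_le [of U] by linarith
    qed
    then have "(set_coord x i r, set_coord L i l) \<in> unified_poly f"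
      using xL r by (auto simp: unified_poly_def bar_set_coord [OF xi] set_coord_nth)
    moreover have "\<forall>j. j \<notin> insert i S \<longrightarrow> set_coord x i r $ j = 0"
      using supp by (simp add: set_coord_nth)
    \<comment> \<open>The added \<open>r\<close> is absorbed by \<open>g T\<close> being at least
      \<open>f M + r\<close>; the witness for \<open>f\<close> is thus \<open>M\<close>, not
      \<open>T\<close>.\<close>
    moreover have "coord_sum (set_coord x i r) \<le> - f M"
      using sum g_ge [of T] by (simp add: coord_sum_set_coord [OF xi])
    ultimately show ?case
      by blast
  qed
qed

theorem theorem1:
  fixes f :: "('l::finite) tree ^ ('n::finite) \<Rightarrow> real"
  assumes "2 \<le> CARD('l)"
    and "k_submodular f"
    and "f root_vec = 0"
  shows "\<exists>m. is_minimum m (range f) \<and>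
             is_maximum m ((\<lambda>(x, L). - coord_sum x) ` unified_poly f)"
proof -
  obtain x L T where xL: "(x, L) \<in> unified_poly f" and T: "coord_sum x \<le> - f T"
    using unified_poly_attains_min [OF assms, of UNIV] by (metis UNIV_I vec_eq_iff)
  \<comment> \<open>Weak duality: it supplies the inequality opposite to \<open>T\<close>, and hence
    optimality on both sides.\<close>
  have weak: "- coord_sum y \<le> f U" if "(y, K) \<in> unified_poly f" for y K U
    using that bar_ge_neg_coord_sum [of y K U]
    by (auto simp: unified_poly_def intro: order_trans)
  have eq: "f T = - coord_sum x"
    using weak [OF xL, of T] T by simp
  have "is_minimum (f T) (range f)"
    unfolding is_minimum_def
    using weak [OF xL] by (metis eq rangeE rangeI)
  moreover have "is_maximum (f T) ((\<lambda>(x, L). - coord_sum x) ` unified_poly f)"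
    unfolding is_maximum_def
  proof
    show "f T \<in> (\<lambda>(x, L). - coord_sum x) ` unified_poly f"
      using xL by (auto simp: eq intro!: image_eqI [of _ _ "(x, L)"])
    show "\<forall>y\<in>(\<lambda>(x, L). - coord_sum x) ` unified_poly f. y \<le> f T"
      using weak by auto
  qed
  ultimately show ?thesis
    by blast
qed

end
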